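(* Let $\theta\mapsto|\phi(\theta)\rangle$ be a differentiable map from an open subset of $\mathbb{R}^p$ to unit vectors in $\mathbb{C}^N$, and let $E(\phi)=\mathcal{E}(|\phi\rangle\langle\phi|)$ with $\mathcal{E}:\mathcal{H}_N\to\mathbb{R}$ differentiable. Let $H(\phi)=\nabla^{(\mathrm{HS})}_\rho\mathcal{E}(\rho)|_{\rho=|\phi\rangle\langle\phi|}$. Consider the variational form of the single-state nonlinear imaginary-time evolution $\frac{d}{dt}|\phi\rangle=-(I-|\phi\rangle\langle\phi|)H(\phi)|\phi\rangle$, in which $\dot\theta\in\mathbb{R}^p$ is chosen at each $\theta$ as $$\dot\theta=\mathop{\arg\min}_{\dot\theta\in\mathbb{R}^p}\left\|(I-|\phi\rangle\langle\phi|)\sum_{i=1}^p\dot\theta_i\,|\partial_{\theta_i}\phi\rangle+(I-|\phi\rangle\langle\phi|)H(\phi)|\phi\rangle\right\|_2^2 .$$ Let $$[G_\theta]_{ij}=\operatorname{Re}\left[\langle\partial_{\theta_i}\phi|\partial_{\theta_j}\phi\rangle-\langle\partial_{\theta_i}\phi|\phi\rangle\langle\phi|\partial_{\theta_j}\phi\rangle\right]$$ be the Fubini--Study metric tensor, assumed invertible at $\theta$. Then the least-squares objective has the form $\dot\theta^TG_\theta\dot\theta+b^T\dot\theta+c$ with $b=\nabla_\theta E(\phi(\theta))$ and $c$ independent of $\dot\theta$, and its solution is $$\dot\theta=-G_\theta^{-1}\nabla_\theta E(\phi(\theta)).$$ Consequently, discretizing time with a time step $\eta$ taken as the learning rate,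 $\Delta\theta=\eta\,\dot\theta$, gives exactly the quantum natural gradient descent update $$\Delta\theta=-\eta\,G_\theta^{-1}\nabla_\theta E(\phi(\theta)).$$
   Context: $\mathcal{H}_N$ is the real vector space of $N\times N$ Hermitian matrices with inner product $\langle X,Y\rangle_{HS}=\operatorname{Tr}(XY)$. The Hilbert--Schmidt gradient $\nabla^{(\mathrm{HS})}_\rho\mathcal{E}(\rho)\in\mathcal{H}_N$ is the unique element with $D\mathcal{E}(\rho)[X]=\operatorname{Tr}(\nabla^{(\mathrm{HS})}_\rho\mathcal{E}(\rho)X)$ for all $X\in\mathcal{H}_N$. $\nabla_\theta E(\phi(\theta))$ is the Euclidean gradient in $\mathbb{R}^p$ of $\theta\mapsto E(\phi(\theta))$, and $|\partial_{\theta_i}\phi\rangle$ is the partial derivative of $|\phi(\theta)\rangle$ with respect to $\theta_i$.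
   Formalization: The stated solution is off by a factor 2: minimizing the quadratic with b = ∇E gives −(1/2)G⁻¹∇E, not −G⁻¹∇E; accordingly a time step η gives the natural gradient update with learning rate η/2, not η. *)

theory Defs
  imports "HOL-Analysis.Analysis"
begin

text \<open>
  State vectors are elements of \<open>complex ^ 'n\<close> (so \<open>norm\<close> is the 2-norm), operators are
  elements of \<open>complex ^ 'n ^ 'n\<close>, and parameters are elements of \<open>real ^ 'p\<close>.
\<close>

definition braket :: "complex ^ 'n \<Rightarrow> complex ^ 'n \<Rightarrow> complex" where
  "braket \<psi> \<omega> = (\<Sum>k\<in>UNIV. cnj (\<psi> $ k) * \<omega> $ k)"

definition ketbra :: "complex ^ 'n \<Rightarrow> complex ^ 'n \<Rightarrow> complex ^ 'n ^ 'n" where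
  "ketbra \<psi> \<omega> = (\<chi> j k. \<psi> $ j * cnj (\<omega> $ k))"

definition hermitian_matrices :: "(complex ^ 'n ^ 'n) set" where
  "hermitian_matrices = {X. \<forall>j k. X $ k $ j = cnj (X $ j $ k)}"

text \<open>
  An energy functional lives on the real subspace of Hermitian matrices only, so derivatives are
  taken within that subspace. Such a derivative is determined only on Hermitian directions,
  which are the only ones used below.
\<close>

definition is_HS_gradient ::
  "(complex ^ 'n ^ 'n \<Rightarrow> real) \<Rightarrow> complex ^ 'n ^ 'n \<Rightarrow> complex ^ 'n ^ 'n \<Rightarrow> bool" where
  "is_HS_gradient \<E> \<rho> G \<longleftrightarrow>
     G \<in> hermitian_matrices \<and>
     (\<forall>X\<in>hermitian_matrices.
        complex_of_real (frechet_derivative \<E> (at \<rho> within hermitian_matrices) X) = trace (G ** X))"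

definition HS_gradient ::
  "(complex ^ 'n ^ 'n \<Rightarrow> real) \<Rightarrow> complex ^ 'n ^ 'n \<Rightarrow> complex ^ 'n ^ 'n" where
  "HS_gradient \<E> \<rho> = (THE G. is_HS_gradient \<E> \<rho> G)"

definition state_energy :: "(complex ^ 'n ^ 'n \<Rightarrow> real) \<Rightarrow> complex ^ 'n \<Rightarrow> real" where
  "state_energy \<E> \<psi> = \<E> (ketbra \<psi> \<psi>)"

definition state_hamiltonian ::
  "(complex ^ 'n ^ 'n \<Rightarrow> real) \<Rightarrow> complex ^ 'n \<Rightarrow> complex ^ 'n ^ 'n" where
  "state_hamiltonian \<E> \<psi> = HS_gradient \<E> (ketbra \<psi> \<psi>)"

definition euclidean_gradient :: "(real ^ 'p \<Rightarrow> real) \<Rightarrow> real ^ 'p \<Rightarrow> real ^ 'p" where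
  "euclidean_gradient f \<theta> = (THE D. GDERIV f \<theta> :> D)"

definition partial_derivative ::
  "(real ^ 'p \<Rightarrow> complex ^ 'n) \<Rightarrow> 'p \<Rightarrow> real ^ 'p \<Rightarrow> complex ^ 'n" where
  "partial_derivative \<phi> i \<theta> = vector_derivative (\<lambda>t. \<phi> (\<theta> + t *\<^sub>R axis i 1)) (at 0)"

definition fubini_study ::
  "(real ^ 'p \<Rightarrow> complex ^ 'n) \<Rightarrow> real ^ 'p \<Rightarrow> real ^ 'p ^ 'p" where
  "fubini_study \<phi> \<theta> = (\<chi> i j.
     Re (braket (partial_derivative \<phi> i \<theta>) (partial_derivative \<phi> j \<theta>)
         - braket (partial_derivative \<phi> i \<theta>) (\<phi> \<theta>) * braket (\<phi> \<theta>) (partial_derivative \<phi> j \<theta>)))"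

definition energy_gradient ::
  "(complex ^ 'n ^ 'n \<Rightarrow> real) \<Rightarrow> (real ^ 'p \<Rightarrow> complex ^ 'n) \<Rightarrow> real ^ 'p \<Rightarrow> real ^ 'p" where
  "energy_gradient \<E> \<phi> \<theta> = euclidean_gradient (\<lambda>\<theta>'. state_energy \<E> (\<phi> \<theta>')) \<theta>"

text \<open>
  The squared residual of the nonlinear imaginary-time evolution
  \<open>d/dt \<phi> = - (I - |\<phi>><\<phi>|) H(\<phi>) \<phi>\<close> when \<open>\<phi>\<close> moves with parameter velocity \<open>v\<close>.
\<close>

definition ite_objective ::
  "(complex ^ 'n ^ 'n \<Rightarrow> real) \<Rightarrow> (real ^ 'p \<Rightarrow> complex ^ 'n) \<Rightarrow> real ^ 'p \<Rightarrow> real ^ 'p \<Rightarrow> real" where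
  "ite_objective \<E> \<phi> \<theta> v =
     (norm ((mat 1 - ketbra (\<phi> \<theta>) (\<phi> \<theta>)) *v (\<Sum>i\<in>UNIV. (v $ i) *\<^sub>R partial_derivative \<phi> i \<theta>)
          + (mat 1 - ketbra (\<phi> \<theta>) (\<phi> \<theta>)) *v (state_hamiltonian \<E> (\<phi> \<theta>) *v \<phi> \<theta>)))\<^sup>2"

definition qngd_update ::
  "(complex ^ 'n ^ 'n \<Rightarrow> real) \<Rightarrow> (real ^ 'p \<Rightarrow> complex ^ 'n) \<Rightarrow> real \<Rightarrow> real ^ 'p \<Rightarrow> real ^ 'p" where
  "qngd_update \<E> \<phi> \<eta> \<theta> =
     - (\<eta> *\<^sub>R (matrix_inv (fubini_study \<phi> \<theta>) *v energy_gradient \<E> \<phi> \<theta>))"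

text \<open>
  Mind the factor 2: a quadratic \<open>v \<bullet> (G *v v) + b \<bullet> v + c\<close> with \<open>G\<close> symmetric positive
  definite is minimised at \<open>- (1/2) G\<^sup>-\<^sup>1 b\<close>. With the normalisations above, \<open>b\<close> is the full energy
  gradient, so a time step \<open>\<eta>\<close> of the variational flow is a natural gradient step with
  learning rate \<open>\<eta>/2\<close>, not \<open>\<eta>\<close>.
\<close>

end

theory Submission
  imports Defs
begin

text \<open>
  With \<open>P = I - |\<phi>><\<phi>|\<close> the objective is an ordinary least-squares problem
  \<open>|\<Sum>\<^sub>i v\<^sub>i a\<^sub>i + r|\<^sup>2\<close> for \<open>a\<^sub>i = P \<partial>\<^sub>i\<phi>\<close> and \<open>r = P H \<phi>\<close>, whose Gram matrix is the
  Fubini--Study tensor. The chain rule gives \<open>\<partial>\<^sub>i E = 2 Re <\<partial>\<^sub>i\<phi>|H\<phi>>\<close>. This equals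
  \<open>2 Re <a\<^sub>i, r>\<close>: the term removed by \<open>P\<close> is \<open><\<partial>\<^sub>i\<phi>|\<phi>><\<phi>|H\<phi>>\<close>, in which the first factor is
  imaginary because \<open>|\<phi>| = 1\<close> and the second is real because \<open>H\<close> is Hermitian.
\<close>

section \<open>Brackets and the projection off a unit vector\<close>

text \<open>Bridge from the complex bracket to the real inner product, in which norms, adjoints and
  gradients are expressed.\<close>

lemma Re_braket: "Re (braket x y) = x \<bullet> y"
  by (simp add: braket_def inner_vec_def inner_complex_def)

lemma cnj_braket: "cnj (braket x y) = braket y x"
  by (simp add: braket_def mult.commute)

lemma braket_diff_left: "braket (x - y) z = braket x z - braket y z"
  by (simp add: braket_def algebra_simps sum_subtractf)

lemma braket_diff_right: "braket x (y - z) = braket x y - braket x z"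
  by (simp add: braket_def algebra_simps sum_subtractf)

lemma braket_mult_left: "braket (c *s x) y = cnj c * braket x y"
  by (simp add: braket_def sum_distrib_left mult_ac)

lemma braket_mult_right: "braket x (c *s y) = c * braket x y"
  by (simp add: braket_def sum_distrib_left mult_ac)

lemma braket_self: "braket x x = complex_of_real ((norm x)\<^sup>2)"
  by (simp add: complex_eq_iff Re_braket power2_norm_eq_inner)
     (simp add: braket_def)

lemma complex_matrix_vector_mult_linear: "linear ((*v) (A :: complex ^ 'n ^ 'm))"
  by (rule linearI)
     (simp_all add: matrix_vector_mult_def vec_eq_iff algebra_simps sum.distrib scaleR_right.sum)

lemma ketbra_mult_vector: "ketbra x y *v z = braket y z *s x"
  by (simp add: ketbra_def braket_def matrix_vector_mult_def vec_eq_iff sum_distrib_left mult_ac)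

text \<open>For a unit vector \<open>u\<close> the matrix \<open>mat 1 - ketbra u u\<close> is
  self-adjoint and idempotent, so projecting one argument suffices. With partial derivatives as
  \<open>x\<close> and \<open>y\<close> the right-hand side is a Fubini-Study entry, which makes
  that tensor a real Gram matrix.\<close>

lemma inner_complement_projection:
  assumes "norm u = 1"
  shows "((mat 1 - ketbra u u) *v x) \<bullet> ((mat 1 - ketbra u u) *v y) =
    Re (braket x y - braket x u * braket u y)"
proof -
  have P: "(mat 1 - ketbra u u) *v z = z - braket u z *s u" for z
    by (simp add: matrix_vector_mult_diff_rdistrib ketbra_mult_vector)
  show ?thesis
    unfolding P Re_braket[symmetric]
    by (simp add: braket_diff_left braket_diff_right braket_mult_left braket_mult_right
        cnj_braket braket_self assms)
qed

section \<open>Hermitian matrices and the trace pairing\<close>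

lemma hermitian_component: "A \<in> hermitian_matrices \<Longrightarrow> A $ k $ j = cnj (A $ j $ k)"
  unfolding hermitian_matrices_def by blast

lemma hermitian_diff:
  assumes A: "A \<in> hermitian_matrices" and B: "B \<in> hermitian_matrices"
  shows "A - B \<in> hermitian_matrices"
proof -
  have "(A - B) $ k $ j = cnj ((A - B) $ j $ k)" for j k
    using hermitian_component[OF A, of k j] hermitian_component[OF B, of k j] by simp
  then show ?thesis
    unfolding hermitian_matrices_def by blast
qed

lemma ketbra_self_hermitian: "ketbra x x \<in> hermitian_matrices"
  by (simp add: hermitian_matrices_def ketbra_def)

lemma ketbra_symmetrized_hermitian: "ketbra x y + ketbra y x \<in> hermitian_matrices"
  by (simp add: hermitian_matrices_def ketbra_def)

lemma trace_mult_ketbra: "trace (A ** ketbra x y) = braket y (A *v x)"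
  by (simp add: trace_def braket_def ketbra_def matrix_matrix_mult_def matrix_vector_mult_def
      sum_distrib_left sum_distrib_right mult_ac)

text \<open>Hermiticity of \<open>B\<close> turns the real part of the trace into the entrywise
  inner product; conjugation only swaps the two summation indices, so the imaginary part vanishes.
  Gradients for the trace pairing thus become Riesz vectors.\<close>

lemma trace_hermitian_mult:
  assumes "A \<in> hermitian_matrices" "B \<in> hermitian_matrices"
  shows "trace (A ** B) = complex_of_real (A \<bullet> B)"
proof -
  have tr: "trace (A ** B) = (\<Sum>i\<in>UNIV. \<Sum>k\<in>UNIV. A $ i $ k * B $ k $ i)"
    by (simp add: trace_def matrix_matrix_mult_def)
  have A: "A $ k $ i = cnj (A $ i $ k)" and B: "B $ k $ i = cnj (B $ i $ k)" for i k
    using assms by (blast intro: hermitian_component)+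
  have "Re (trace (A ** B)) = A \<bullet> B"
    unfolding tr by (subst B) (simp add: inner_vec_def inner_complex_def)
  moreover have "cnj (trace (A ** B)) = trace (A ** B)"
  proof -
    have "cnj (trace (A ** B)) = (\<Sum>i\<in>UNIV. \<Sum>k\<in>UNIV. A $ k $ i * B $ i $ k)"
      unfolding tr by (simp flip: A B)
    also have "\<dots> = trace (A ** B)"
      unfolding tr by (rule sum.swap)
    finally show ?thesis .
  qed
  ultimately show ?thesis
    by (simp add: complex_eq_iff)
qed

lemma braket_hermitian_mult:
  assumes "A \<in> hermitian_matrices"
  shows "braket x (A *v y) = braket (A *v x) y"
proof -
  have A: "A $ i $ k = cnj (A $ k $ i)" for i k
    using assms by (rule hermitian_component)
  have "braket x (A *v y) = (\<Sum>i\<in>UNIV. \<Sum>k\<in>UNIV. cnj (A $ k $ i) * cnj (x $ i) * y $ k)"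
    by (simp add: braket_def matrix_vector_mult_def sum_distrib_left mult_ac flip: A)
  also have "\<dots> = (\<Sum>k\<in>UNIV. \<Sum>i\<in>UNIV. cnj (A $ k $ i) * cnj (x $ i) * y $ k)"
    by (rule sum.swap)
  also have "\<dots> = braket (A *v x) y"
    by (simp add: braket_def matrix_vector_mult_def sum_distrib_right)
  finally show ?thesis .
qed

section \<open>Well-definedness of the Hilbert-Schmidt gradient\<close>

lemma is_HS_gradient_HS_gradient:
  assumes "linear (frechet_derivative \<E> (at \<rho> within hermitian_matrices))"
  shows "is_HS_gradient \<E> \<rho> (HS_gradient \<E> \<rho>)"
proof -
  define F where "F = frechet_derivative \<E> (at \<rho> within hermitian_matrices)"
  \<comment> \<open>The adjoint of a real functional, applied to \<open>1\<close>, is its Riesz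
    vector.\<close>
  define g where "g = adjoint F 1"
  define dag :: "complex ^ 'a ^ 'a \<Rightarrow> complex ^ 'a ^ 'a"
    where "dag X = (\<chi> j k. cnj (X $ k $ j))" for X
  \<comment> \<open>Off the Hermitian subspace \<open>F\<close> is arbitrary, so its Riesz vector \<open>g\<close> need not be Hermitian;
    symmetrizing it does not change its pairing with Hermitian matrices.\<close>
  define G where "G = (1/2) *\<^sub>R (g + dag g)"
  have Fg: "F X = g \<bullet> X" for X
    using adjoint_works[OF assms[folded F_def], of X 1] by (simp add: g_def inner_commute)
  have dag_inner: "dag X \<bullet> Y = X \<bullet> Y" if "Y \<in> hermitian_matrices" for X Y
  proof -
    have Y: "Y $ k $ i = cnj (Y $ i $ k)" for i k
      using that by (rule hermitian_component)
    have "dag X \<bullet> Y = (\<Sum>i\<in>UNIV. \<Sum>k\<in>UNIV. X $ k $ i \<bullet> cnj (Y $ i $ k))"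
      by (simp add: inner_vec_def dag_def inner_complex_def)
    also have "\<dots> = (\<Sum>k\<in>UNIV. \<Sum>i\<in>UNIV. X $ k $ i \<bullet> cnj (Y $ i $ k))"
      by (rule sum.swap)
    also have "\<dots> = X \<bullet> Y"
      by (simp add: inner_vec_def flip: Y)
    finally show ?thesis .
  qed
  have GH: "G \<in> hermitian_matrices"
    by (simp add: G_def dag_def hermitian_matrices_def add.commute)
  have GF: "G \<bullet> X = F X" if "X \<in> hermitian_matrices" for X
    using that by (simp add: G_def inner_add_left dag_inner Fg)
  have G: "is_HS_gradient \<E> \<rho> G"
    unfolding is_HS_gradient_def F_def[symmetric]
    using GH GF by (simp add: trace_hermitian_mult)
  have "G' = G" if "is_HS_gradient \<E> \<rho> G'" for G'
  proof -
    have G'H: "G' \<in> hermitian_matrices"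
      using that by (simp add: is_HS_gradient_def)
    have "G' \<bullet> X = F X" if "X \<in> hermitian_matrices" for X
      using \<open>is_HS_gradient \<E> \<rho> G'\<close> that trace_hermitian_mult[OF G'H that]
      unfolding is_HS_gradient_def F_def[symmetric] by (metis of_real_eq_iff)
    then have "(G' - G) \<bullet> X = 0" if "X \<in> hermitian_matrices" for X
      using that by (simp add: inner_diff_left GF)
    \<comment> \<open>The difference is itself an admissible test matrix, hence orthogonal to
      itself.\<close>
    moreover have "G' - G \<in> hermitian_matrices"
      using G'H GH by (rule hermitian_diff)
    ultimately show ?thesis
      by (metis inner_eq_zero_iff right_minus_eq)
  qed
  then show ?thesis
    unfolding HS_gradient_def using G by (rule theI[rotated])
qed

section \<open>Differentiating the energy along parametrized states\<close>

lemma has_derivative_imp_partial_derivative: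
  assumes "(\<phi> has_derivative D) (at \<theta>)"
  shows "partial_derivative \<phi> i \<theta> = D (axis i 1)"
proof -
  have "((\<lambda>t. \<phi> (\<theta> + t *\<^sub>R axis i 1)) has_derivative (\<lambda>t. D (t *\<^sub>R axis i 1))) (at 0)"
    by (rule has_derivative_compose[of "\<lambda>t. \<theta> + t *\<^sub>R axis i 1"])
       (use assms in \<open>auto intro!: derivative_eq_intros\<close>)
  then show ?thesis
    using has_derivative_linear[OF assms]
    by (simp add: partial_derivative_def vector_derivative_at has_vector_derivative_def
        linear_scale)
qed

text \<open>Conjugate-linearity in the second argument is still linearity over the reals, and finite
  dimension gives boundedness.\<close>

lemma bounded_bilinear_ketbra: "bounded_bilinear ketbra"
proof -
  have "bilinear (ketbra :: complex ^ 'n \<Rightarrow> complex ^ 'n \<Rightarrow> _)"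
    unfolding bilinear_def
    by (auto intro!: linearI simp: ketbra_def vec_eq_iff algebra_simps)
  then show ?thesis
    using bilinear_conv_bounded_bilinear by blast
qed

lemma is_HS_gradient_state_hamiltonian:
  assumes "\<E> differentiable_on hermitian_matrices"
  shows "is_HS_gradient \<E> (ketbra \<psi> \<psi>) (state_hamiltonian \<E> \<psi>)"
proof -
  have "\<E> differentiable (at (ketbra \<psi> \<psi>) within hermitian_matrices)"
    using assms ketbra_self_hermitian by (auto simp: differentiable_on_def)
  then show ?thesis
    unfolding state_hamiltonian_def frechet_derivative_works
    by (intro is_HS_gradient_HS_gradient has_derivative_linear)
qed

lemma has_derivative_state_energy:
  assumes "\<E> differentiable_on hermitian_matrices" and \<phi>: "(\<phi> has_derivative D) (at \<theta>)"
  shows "((\<lambda>\<theta>'. state_energy \<E> (\<phi> \<theta>')) has_derivative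
    (\<lambda>h. 2 * (D h \<bullet> (state_hamiltonian \<E> (\<phi> \<theta>) *v \<phi> \<theta>)))) (at \<theta>)"
proof -
  define F where "F = frechet_derivative \<E> (at (ketbra (\<phi> \<theta>) (\<phi> \<theta>)) within hermitian_matrices)"
  define H where "H = state_hamiltonian \<E> (\<phi> \<theta>)"
  have F: "(\<E> has_derivative F) (at (ketbra (\<phi> \<theta>) (\<phi> \<theta>)) within hermitian_matrices)"
    using assms(1) ketbra_self_hermitian
    by (auto simp: F_def differentiable_on_def frechet_derivative_works[symmetric])
  have H: "is_HS_gradient \<E> (ketbra (\<phi> \<theta>) (\<phi> \<theta>)) H"
    unfolding H_def by (rule is_HS_gradient_state_hamiltonian[OF assms(1)])
  have "((\<lambda>\<theta>'. ketbra (\<phi> \<theta>') (\<phi> \<theta>')) has_derivative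
      (\<lambda>h. ketbra (\<phi> \<theta>) (D h) + ketbra (D h) (\<phi> \<theta>))) (at \<theta>)"
    by (rule bounded_bilinear.FDERIV[OF bounded_bilinear_ketbra \<phi> \<phi>])
  \<comment> \<open>\<open>\<E>\<close> is differentiable only within the Hermitian subspace; the
    chain rule still applies because every \<open>ketbra\<close> of a state with itself lies
    there.\<close>
  moreover have "(\<E> has_derivative F)
      (at (ketbra (\<phi> \<theta>) (\<phi> \<theta>)) within range (\<lambda>\<theta>'. ketbra (\<phi> \<theta>') (\<phi> \<theta>')))"
    using F by (rule has_derivative_subset) (auto simp: ketbra_self_hermitian)
  ultimately have "((\<lambda>\<theta>'. \<E> (ketbra (\<phi> \<theta>') (\<phi> \<theta>'))) has_derivative
      (\<lambda>h. F (ketbra (\<phi> \<theta>) (D h) + ketbra (D h) (\<phi> \<theta>)))) (at \<theta>)"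
    by (rule has_derivative_in_compose)
  moreover have "F (ketbra x y + ketbra y x) = 2 * (y \<bullet> (H *v x))" for x y
  proof -
    have "complex_of_real (F (ketbra x y + ketbra y x)) = trace (H ** (ketbra x y + ketbra y x))"
      using H ketbra_symmetrized_hermitian[of x y] by (simp add: is_HS_gradient_def F_def)
    \<comment> \<open>The two product-rule terms are conjugate because \<open>H\<close> is
      Hermitian; their sum, twice a real part, is the source of the factor 2 in the energy
      gradient.\<close>
    also have "\<dots> = braket y (H *v x) + cnj (braket y (H *v x))"
      using H by (simp add: matrix_add_ldistrib trace_add trace_mult_ketbra cnj_braket
          braket_hermitian_mult is_HS_gradient_def)
    finally show ?thesis
      by (simp add: complex_add_cnj Re_braket flip: of_real_eq_iff[where 'a=complex])
  qed
  ultimately show ?thesis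
    by (simp add: state_energy_def H_def)
qed

section \<open>Least squares with a Gram matrix\<close>

text \<open>\<open>G\<close> factors as the adjoint of the map from \<open>v\<close> to the
  combination of the \<open>a i\<close>, composed with that map. Symmetry, nonnegativity and the
  kernel of \<open>G\<close> are read off from this.\<close>

lemma gram_matrix_quadratic_form:
  fixes a :: "'p::finite \<Rightarrow> 'a::real_inner"
  assumes "\<And>i j. G $ i $ j = a i \<bullet> a j"
  shows "(G *v v) $ i = a i \<bullet> (\<Sum>j\<in>UNIV. v $ j *\<^sub>R a j)"
    and "w \<bullet> (G *v v) = (\<Sum>i\<in>UNIV. w $ i *\<^sub>R a i) \<bullet> (\<Sum>i\<in>UNIV. v $ i *\<^sub>R a i)"
proof -
  show *: "(G *v v) $ i = a i \<bullet> (\<Sum>j\<in>UNIV. v $ j *\<^sub>R a j)" for i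
    by (simp add: matrix_vector_mult_def assms inner_sum_right mult.commute)
  show "w \<bullet> (G *v v) = (\<Sum>i\<in>UNIV. w $ i *\<^sub>R a i) \<bullet> (\<Sum>i\<in>UNIV. v $ i *\<^sub>R a i)"
    by (simp add: inner_vec_def * inner_sum_left)
qed

lemma gram_least_squares:
  fixes a :: "'p::finite \<Rightarrow> 'a::real_inner" and G :: "real ^ 'p ^ 'p"
  assumes G: "\<And>i j. G $ i $ j = a i \<bullet> a j"
    and b: "\<And>i. b $ i = 2 * (a i \<bullet> r)"
  shows "(norm ((\<Sum>i\<in>UNIV. v $ i *\<^sub>R a i) + r))\<^sup>2 = v \<bullet> (G *v v) + b \<bullet> v + (norm r)\<^sup>2"
proof -
  have "b \<bullet> v = 2 * ((\<Sum>i\<in>UNIV. v $ i *\<^sub>R a i) \<bullet> r)"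
    by (simp add: inner_vec_def b inner_sum_left sum_distrib_left mult_ac)
  then show ?thesis
    by (simp add: gram_matrix_quadratic_form(2)[OF G] power2_norm_eq_inner inner_add_left
        inner_add_right inner_commute)
qed

text \<open>Complete the square around the zero \<open>v0\<close> of the gradient
  \<open>2 G v + b\<close>, whence the factor 1/2. A Gram matrix is only semidefinite in general;
  invertibility makes it definite and the minimizer unique.\<close>

lemma gram_quadratic_arg_min:
  fixes a :: "'p::finite \<Rightarrow> 'a::real_inner" and G :: "real ^ 'p ^ 'p"
  assumes G: "\<And>i j. G $ i $ j = a i \<bullet> a j"
    and "invertible G"
    and f: "\<And>v. f v = v \<bullet> (G *v v) + b \<bullet> v + c"
  shows "is_arg_min f (\<lambda>_. True) v \<longleftrightarrow> v = - ((1/2) *\<^sub>R (matrix_inv G *v b))"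
proof -
  define v0 where "v0 = - ((1/2) *\<^sub>R (matrix_inv G *v b))"
  have inv: "G ** matrix_inv G = mat 1" "matrix_inv G ** G = mat 1"
    using someI_ex[OF \<open>invertible G\<close>[unfolded invertible_def]] by (simp_all add: matrix_inv_def)
  have b: "b = - 2 *\<^sub>R (G *v v0)"
    by (simp add: v0_def matrix_vector_mult_scaleR matrix_vector_mul_assoc inv
        linear_neg[OF matrix_vector_mul_linear])
  have sym: "x \<bullet> (G *v y) = y \<bullet> (G *v x)" for x y
    by (simp add: gram_matrix_quadratic_form(2)[OF G] inner_commute)
  \<comment> \<open>Substituting \<open>b = - 2 G v0\<close> cancels the terms linear in
    \<open>w - v0\<close>, by symmetry of \<open>G\<close>.\<close>
  have square: "f w = f v0 + (w - v0) \<bullet> (G *v (w - v0))" for w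
    using sym[of w v0] inner_commute[of w "G *v v0"] inner_commute[of v0 "G *v v0"]
    by (simp add: f b inner_diff_left inner_diff_right algebra_simps)
  have nonneg: "0 \<le> x \<bullet> (G *v x)" for x
    by (simp add: gram_matrix_quadratic_form(2)[OF G])
  have definite: "x = 0" if "x \<bullet> (G *v x) = 0" for x
  proof -
    have "(\<Sum>i\<in>UNIV. x $ i *\<^sub>R a i) = 0"
      using that by (simp add: gram_matrix_quadratic_form(2)[OF G])
    then have "G *v x = 0"
      by (simp add: vec_eq_iff gram_matrix_quadratic_form(1)[OF G])
    then have "(matrix_inv G ** G) *v x = 0"
      by (simp flip: matrix_vector_mul_assoc)
    then show ?thesis
      by (simp add: inv)
  qed
  have "is_arg_min f (\<lambda>_. True) v \<longleftrightarrow> v = v0"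
  proof
    assume "is_arg_min f (\<lambda>_. True) v"
    then have "f v \<le> f v0"
      by (auto simp: is_arg_min_def not_less)
    then have "(v - v0) \<bullet> (G *v (v - v0)) = 0"
      using square[of v] nonneg[of "v - v0"] by linarith
    then show "v = v0"
      using definite by fastforce
  next
    assume "v = v0"
    moreover have "f v0 \<le> f w" for w
      using square[of w] nonneg[of "w - v0"] by linarith
    ultimately show "is_arg_min f (\<lambda>_. True) v"
      by (simp add: is_arg_min_def not_less)
  qed
  then show ?thesis
    by (simp add: v0_def)
qed

section \<open>The energy gradient and the unit-norm constraint\<close>

lemma euclidean_gradient_eqI:
  assumes "GDERIV f \<theta> :> g"
  shows "euclidean_gradient f \<theta> = g"
  unfolding euclidean_gradient_def
proof (rule the_equality)
  fix g' assume "GDERIV f \<theta> :> g'"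
  then have "(\<lambda>h. h \<bullet> g') = (\<lambda>h. h \<bullet> g)"
    using assms has_derivative_unique unfolding gderiv_def by blast
  then show "g' = g"
    unfolding fun_eq_iff vector_eq_ldot .
qed (rule assms)

lemma energy_gradient_component:
  assumes "\<E> differentiable_on hermitian_matrices" and \<phi>: "(\<phi> has_derivative D) (at \<theta>)"
  shows "energy_gradient \<E> \<phi> \<theta> $ i =
    2 * (partial_derivative \<phi> i \<theta> \<bullet> (state_hamiltonian \<E> (\<phi> \<theta>) *v \<phi> \<theta>))"
proof -
  define r where "r = state_hamiltonian \<E> (\<phi> \<theta>) *v \<phi> \<theta>"
  \<comment> \<open>Moving \<open>D\<close> across the inner product exposes the gradient; pairing
    it with \<open>axis i 1\<close> then extracts a component.\<close>
  define g where "g = 2 *\<^sub>R adjoint D r"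
  have g: "2 * (D h \<bullet> r) = h \<bullet> g" for h
    using adjoint_works[OF has_derivative_linear[OF \<phi>], of h r] by (simp add: g_def)
  have "energy_gradient \<E> \<phi> \<theta> = g"
    using has_derivative_state_energy[OF assms] unfolding energy_gradient_def
    by (intro euclidean_gradient_eqI) (simp add: gderiv_def g flip: r_def)
  then show ?thesis
    using g[of "axis i 1"] has_derivative_imp_partial_derivative[OF \<phi>, of i]
    by (simp add: inner_axis' r_def)
qed


text \<open>Differentiate the squared norm, constant on a neighbourhood of \<open>\<theta>\<close>
  since \<open>U\<close> is open. Only the real part of the bracket is forced to vanish; a phase
  velocity may remain.\<close>

lemma inner_derivative_of_unit_vectors:
  assumes "open U" "\<theta> \<in> U" "\<And>\<theta>'. \<theta>' \<in> U \<Longrightarrow> norm (\<phi> \<theta>') = 1"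
    and \<phi>: "(\<phi> has_derivative D) (at \<theta>)"
  shows "D h \<bullet> \<phi> \<theta> = 0"
proof -
  have "((\<lambda>x. \<phi> x \<bullet> \<phi> x) has_derivative (\<lambda>h. \<phi> \<theta> \<bullet> D h + D h \<bullet> \<phi> \<theta>)) (at \<theta>)"
    by (rule has_derivative_inner[OF \<phi> \<phi>])
  moreover have "((\<lambda>x. \<phi> x \<bullet> \<phi> x) has_derivative (\<lambda>h. 0)) (at \<theta>)"
    by (rule has_derivative_transform_within_open[OF has_derivative_const[of 1] assms(1,2)])
       (simp add: assms(3) flip: power2_norm_eq_inner)
  ultimately have "\<phi> \<theta> \<bullet> D h + D h \<bullet> \<phi> \<theta> = 0"
    using has_derivative_unique by (metis (no_types, lifting))
  then show ?thesis
    by (simp add: inner_commute)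
qed

text \<open>The linear coefficient is the full energy gradient, so the minimizer carries a factor
  1/2 and a time step \<open>\<eta>\<close> is a natural gradient step of rate
  \<open>\<eta> / 2\<close>. Without the 1/2 the formula would be correct only where the gradient
  vanishes. The equivalence with \<open>is_arg_min\<close> gives existence and uniqueness
  together.\<close>

theorem mainTheorem4:
  fixes U :: "(real ^ 'p) set"
    and \<phi> :: "real ^ 'p \<Rightarrow> complex ^ 'n"
    and \<E> :: "complex ^ 'n ^ 'n \<Rightarrow> real"
    and \<theta> :: "real ^ 'p"
  assumes "open U"
    and "\<phi> differentiable_on U"
    and "\<And>\<theta>'. \<theta>' \<in> U \<Longrightarrow> norm (\<phi> \<theta>') = 1"
    and "\<E> differentiable_on hermitian_matrices"
    and "\<theta> \<in> U"
    and "invertible (fubini_study \<phi> \<theta>)"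
  shows "(\<exists>c. \<forall>v. ite_objective \<E> \<phi> \<theta> v =
             v \<bullet> (fubini_study \<phi> \<theta> *v v) + energy_gradient \<E> \<phi> \<theta> \<bullet> v + c) \<and>
         (\<forall>v. is_arg_min (ite_objective \<E> \<phi> \<theta>) (\<lambda>_. True) v \<longleftrightarrow>
             v = - ((1/2) *\<^sub>R (matrix_inv (fubini_study \<phi> \<theta>) *v energy_gradient \<E> \<phi> \<theta>))) \<and>
         (\<forall>v. is_arg_min (ite_objective \<E> \<phi> \<theta>) (\<lambda>_. True) v \<longrightarrow>
             (\<forall>\<eta>. \<eta> *\<^sub>R v = qngd_update \<E> \<phi> (\<eta> / 2) \<theta>))"
proof -
  define u where "u = \<phi> \<theta>"
  define P where "P = mat 1 - ketbra u u"
  define H where "H = state_hamiltonian \<E> u"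
  define a where "a i = P *v partial_derivative \<phi> i \<theta>" for i
  define r where "r = P *v (H *v u)"
  have u: "norm u = 1"
    using assms(3,5) by (simp add: u_def)
  obtain D where D: "(\<phi> has_derivative D) (at \<theta>)"
    using assms(1,2,5) by (auto simp: differentiable_on_eq_differentiable_at differentiable_def)
  have objective: "ite_objective \<E> \<phi> \<theta> v = (norm ((\<Sum>i\<in>UNIV. v $ i *\<^sub>R a i) + r))\<^sup>2" for v
    unfolding ite_objective_def a_def r_def P_def H_def u_def
    by (simp add: linear_sum[OF complex_matrix_vector_mult_linear]
        linear_scale[OF complex_matrix_vector_mult_linear])
  have G: "fubini_study \<phi> \<theta> $ i $ j = a i \<bullet> a j" for i j
    by (simp add: fubini_study_def a_def P_def inner_complement_projection[OF u] flip: u_def)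
  have b: "energy_gradient \<E> \<phi> \<theta> $ i = 2 * (a i \<bullet> r)" for i
  proof -
    define d where "d = partial_derivative \<phi> i \<theta>"
    have "Re (braket d u) = 0"
      unfolding Re_braket d_def u_def has_derivative_imp_partial_derivative[OF D]
      by (rule inner_derivative_of_unit_vectors[OF assms(1,5,3) D])
    moreover have "Im (braket u (H *v u)) = 0"
    proof -
      have "H \<in> hermitian_matrices"
        using is_HS_gradient_state_hamiltonian[OF assms(4)] by (simp add: H_def is_HS_gradient_def)
      then have "cnj (braket u (H *v u)) = braket u (H *v u)"
        by (simp add: braket_hermitian_mult cnj_braket)
      then show ?thesis
        by (simp add: complex_eq_iff)
    qed
    ultimately have "a i \<bullet> r = d \<bullet> (H *v u)"
      by (simp add: a_def r_def P_def d_def[symmetric] inner_complement_projection[OF u] Re_braket)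
    then show ?thesis
      by (simp add: energy_gradient_component[OF assms(4) D] d_def H_def u_def)
  qed
  \<comment> \<open>The constant is the squared norm of the projected \<open>H u\<close>,
    independent of the velocity.\<close>
  have quadratic: "ite_objective \<E> \<phi> \<theta> v =
      v \<bullet> (fubini_study \<phi> \<theta> *v v) + energy_gradient \<E> \<phi> \<theta> \<bullet> v + (norm r)\<^sup>2" for v
    unfolding objective using G b by (rule gram_least_squares)
  have arg_min: "is_arg_min (ite_objective \<E> \<phi> \<theta>) (\<lambda>_. True) v \<longleftrightarrow>
      v = - ((1/2) *\<^sub>R (matrix_inv (fubini_study \<phi> \<theta>) *v energy_gradient \<E> \<phi> \<theta>))" for v
    by (rule gram_quadratic_arg_min[of _ a, OF G assms(6) quadratic])
  show ?thesis
    unfolding arg_min using quadratic by (auto simp: qngd_update_def)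
qed

end
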